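(* Let $L\in\mathscr{S}_d$ be an admissible lattice. Let $(\theta_\delta)_{\delta\in\Delta}$ be a family of independent identically distributed real random variables, defined on a probability space $\Omega$, that are symmetrical and admit a moment of order $3$. Set $$\tilde V(L,r)=\sum_{\delta\in\Delta_r}\frac{1}{\|\delta L\|^{2d}},\qquad \tilde S(L,\omega,r)=\sum_{\delta\in\Delta_r}\frac{\theta_\delta(\omega)}{\|\delta L\|^{d}}\quad(\omega\in\Omega).$$ Then $\tilde V(L,r)=\Theta(r^{d-1})$, i.e. there exists $C>0$ such that $\frac1C r^{d-1}\leqslant\tilde V(L,r)\leqslant Cr^{d-1}$ for all $r$ large enough, and $\frac{\tilde S(L,\omega,r)}{\sqrt{\tilde V(L,r)}}$ converges in distribution towards the standard normal distribution when $r\to\infty$.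
   Context: $\mathscr{S}_d$ is the space of unimodular lattices of $\mathbb{R}^d$ (covolume $1$). A lattice $L$ of $\mathbb{R}^d$ is admissible if there is $C>0$ with $|l_1\cdots l_d|\geqslant C$ for all $l=(l_1,\dots,l_d)\in L\setminus\{0\}$. For a lattice $L$, $\|L\|=\min\{\|l\| : l\in L\setminus\{0\}\}$, with $\|\cdot\|$ the Euclidean norm. $\Delta=\{\mathrm{Diag}(e^{t_1},\dots,e^{t_d}) : (t_1,\dots,t_d)\in\mathbb{Z}^d,\ t_1+\cdots+t_d=0\}$, and $\Delta_r$ is the subset of those elements with $\|(t_1,\dots,t_d)\|\leqslant r$. A random variable $\theta$ is symmetrical if $\theta$ and $-\theta$ have the same distribution.
   Formalization: The dimension d is assumed at least 2 (the limit claim fails in general for d = 1), and the limit law is that of σN with N standard normal and σ² = E[θ²], since the claimed standard normal limit fails unless the variance is 1 (e.g. θ = 0). *)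

theory Defs
  imports "HOL-Probability.Probability"
begin

text \<open>The ambient space is \<open>real ^ 'n\<close>, of dimension \<open>d = CARD('n)\<close>.\<close>

definition of_int_vec :: "int ^ 'n \<Rightarrow> real ^ 'n" where
  "of_int_vec z = (\<chi> i. real_of_int (z $ i))"

text \<open>The columns of \<open>A\<close> are a basis of the lattice, whose covolume is then \<open>\<bar>det A\<bar>\<close>.\<close>

definition lattice_of :: "real ^ 'n ^ 'n \<Rightarrow> (real ^ 'n) set" where
  "lattice_of A = range (\<lambda>z. A *v of_int_vec z)"

definition unimodular_lattice :: "(real ^ 'n) set \<Rightarrow> bool" where
  "unimodular_lattice L \<longleftrightarrow> (\<exists>A. \<bar>det A\<bar> = 1 \<and> L = lattice_of A)"

definition admissible :: "(real ^ 'n) set \<Rightarrow> bool" where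
  "admissible L \<longleftrightarrow> (\<exists>C>0. \<forall>l \<in> L - {0}. \<bar>\<Prod>i\<in>UNIV. l $ i\<bar> \<ge> C)"

text \<open>On a lattice the infimum is attained, see \<open>lattice_norm_attained\<close> below.\<close>

definition lattice_norm :: "(real ^ 'n) set \<Rightarrow> real" where
  "lattice_norm L = Inf (norm ` (L - {0}))"

definition diag_exp :: "int ^ 'n \<Rightarrow> real ^ 'n ^ 'n" where
  "diag_exp t = (\<chi> i j. if i = j then exp (real_of_int (t $ i)) else 0)"

definition Delta :: "(real ^ 'n ^ 'n) set" where
  "Delta = {diag_exp t |t. (\<Sum>i\<in>UNIV. t $ i) = 0}"

definition Delta_le :: "real \<Rightarrow> (real ^ 'n ^ 'n) set" where
  "Delta_le r = {diag_exp t |t. (\<Sum>i\<in>UNIV. t $ i) = 0 \<and> norm (of_int_vec t) \<le> r}"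

definition V_tilde :: "(real ^ 'n) set \<Rightarrow> real \<Rightarrow> real" where
  "V_tilde L r = (\<Sum>\<delta>\<in>Delta_le r. 1 / lattice_norm ((*v) \<delta> ` L) ^ (2 * CARD('n)))"

definition S_tilde :: "(real ^ 'n ^ 'n \<Rightarrow> 'w \<Rightarrow> real) \<Rightarrow> (real ^ 'n) set \<Rightarrow> 'w \<Rightarrow> real \<Rightarrow> real" where
  "S_tilde \<theta> L \<omega> r = (\<Sum>\<delta>\<in>Delta_le r. \<theta> \<delta> \<omega> / lattice_norm ((*v) \<delta> ` L) ^ CARD('n))"

text \<open>
  \<^const>\<open>weak_conv_m\<close> only covers sequences of measures; this is the same notion for
  an arbitrary filter, see \<open>weak_conv_along_sequentially\<close>.
\<close>

definition weak_conv_along :: "('a \<Rightarrow> real measure) \<Rightarrow> real measure \<Rightarrow> 'a filter \<Rightarrow> bool" where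
  "weak_conv_along \<mu> \<nu> F \<longleftrightarrow>
     (\<forall>x. isCont (cdf \<nu>) x \<longrightarrow> ((\<lambda>r. cdf (\<mu> r) x) \<longlongrightarrow> cdf \<nu> x) F)"

lemma weak_conv_along_sequentially:
  "weak_conv_along \<mu> \<nu> sequentially \<longleftrightarrow> weak_conv_m \<mu> \<nu>"
  by (simp add: weak_conv_along_def weak_conv_m_def weak_conv_def)

lemma distr_std_normal_scale_1: "distr std_normal_distribution borel (\<lambda>x. 1 * x) = std_normal_distribution"
  by (simp add: distr_id2)

lemma finite_int_vec_norm_le: "finite {z :: int ^ 'n. norm (of_int_vec z) \<le> r}"
proof -
  let ?B = "{- \<lceil>r\<rceil> .. \<lceil>r\<rceil>}"
  have "z \<in> vec_lambda ` (UNIV \<rightarrow>\<^sub>E ?B)" if "norm (of_int_vec z) \<le> r" for z :: "int ^ 'n"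
  proof -
    have "\<bar>real_of_int (z $ i)\<bar> \<le> r" for i
      using component_le_norm_cart[of "of_int_vec z" i] that by (simp add: of_int_vec_def)
    then have "\<bar>real_of_int (z $ i)\<bar> \<le> real_of_int \<lceil>r\<rceil>" for i
      using le_of_int_ceiling order_trans by blast
    then have "\<bar>z $ i\<bar> \<le> \<lceil>r\<rceil>" for i
      by (metis of_int_abs of_int_le_iff)
    then have "z $ i \<in> ?B" for i
      by (simp add: abs_le_iff minus_le_iff)
    then have "vec_nth z \<in> UNIV \<rightarrow>\<^sub>E ?B"
      by auto
    then show ?thesis
      by (metis image_eqI vec_nth_inverse)
  qed
  then have "{z :: int ^ 'n. norm (of_int_vec z) \<le> r} \<subseteq> vec_lambda ` (UNIV \<rightarrow>\<^sub>E ?B)"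
    by blast
  moreover have "finite (vec_lambda ` (UNIV \<rightarrow>\<^sub>E ?B) :: (int ^ 'n) set)"
    by (intro finite_imageI finite_PiE) auto
  ultimately show ?thesis
    by (rule finite_subset)
qed

lemma finite_Delta_le: "finite (Delta_le r :: (real ^ 'n ^ 'n) set)"
proof -
  have "(Delta_le r :: (real ^ 'n ^ 'n) set) \<subseteq> diag_exp ` {t. norm (of_int_vec t) \<le> r}"
    by (auto simp: Delta_le_def)
  then show ?thesis
    by (rule finite_subset) (intro finite_imageI finite_int_vec_norm_le)
qed

lemma lattice_norm_attained:
  fixes A :: "real ^ 'n ^ 'n"
  assumes A: "invertible A"
  obtains l where "l \<in> lattice_of A - {0}" "norm l = lattice_norm (lattice_of A)"
    "\<And>l'. l' \<in> lattice_of A - {0} \<Longrightarrow> norm l \<le> norm l'"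
proof -
  obtain B where B: "B ** A = mat 1"
    using A by (auto simp: invertible_def)
  have BA: "B *v (A *v x) = x" for x
    using B by (simp add: matrix_vector_mul_assoc)
  define K where "K = onorm ((*v) B)"
  have K: "norm x \<le> K * norm (A *v x)" for x
    using onorm[of "(*v) B" "A *v x"] BA[of x] by (simp add: K_def)
  have fin: "finite {l \<in> lattice_of A. norm l \<le> R}" for R
  proof -
    have "norm (of_int_vec z) \<le> K * R" if "norm (A *v of_int_vec z) \<le> R" for z
      using K[of "of_int_vec z"] that onorm_pos_le[of "(*v) B"]
        mult_left_mono[of "norm (A *v of_int_vec z)" R K]
      by (simp add: K_def)
    then have "{l \<in> lattice_of A. norm l \<le> R}
        \<subseteq> (\<lambda>z. A *v of_int_vec z) ` {z. norm (of_int_vec z) \<le> K * R}"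
      by (auto simp: lattice_of_def)
    then show ?thesis
      by (rule finite_subset) (intro finite_imageI finite_int_vec_norm_le)
  qed
  define l0 where "l0 = A *v of_int_vec (\<chi> i. 1)"
  have "l0 \<noteq> 0"
  proof
    assume "l0 = 0"
    then have "of_int_vec (\<chi> i. 1) = (0 :: real ^ 'n)"
      using BA[of "of_int_vec (\<chi> i. 1)"] by (simp add: l0_def)
    then show False
      by (simp add: of_int_vec_def vec_eq_iff)
  qed
  then have l0: "l0 \<in> lattice_of A - {0}"
    by (auto simp: l0_def lattice_of_def)
  let ?S = "{l \<in> lattice_of A. norm l \<le> norm l0} - {0}"
  have "finite ?S" "?S \<noteq> {}"
    using fin[of "norm l0"] l0 by auto
  then obtain l where l: "l \<in> ?S" "\<And>l'. l' \<in> ?S \<Longrightarrow> norm l \<le> norm l'"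
    using finite_has_minimal[of "norm ` ?S"]
    by (metis (no_types, lifting) arg_min_least arg_min_if_finite(1))
  have min: "norm l \<le> norm l'" if "l' \<in> lattice_of A - {0}" for l'
  proof (cases "norm l' \<le> norm l0")
    case True
    then show ?thesis using that l(2) by blast
  next
    case False
    moreover have "norm l \<le> norm l0" using l(1) by blast
    ultimately show ?thesis by linarith
  qed
  have "norm l = lattice_norm (lattice_of A)"
    unfolding lattice_norm_def
    by (rule cInf_eq_minimum[symmetric]) (use l(1) min in auto)
  with l(1) min show ?thesis
    using that by auto
qed

end

theory Submission
  imports Defs
begin

text \<open>
  A diagonal matrix \<open>\<delta>\<close> of determinant \<open>1\<close> preserves the product of the coordinates, so
  admissibility and \<open>\<bar>x\<^sub>1 \<cdots> x\<^sub>d\<bar> \<le> \<parallel>x\<parallel>\<^sup>d\<close> bound \<open>\<parallel>\<delta> L\<parallel>\<close> from below uniformly in \<open>\<delta>\<close>, while a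
  pigeonhole argument bounds it from above.  Hence the weights \<open>w\<^sub>\<delta> = \<parallel>\<delta> L\<parallel>\<^sup>-\<^sup>d\<close> lie between two
  positive constants, and \<open>V\<close> is comparable to the number of points of \<open>\<Delta>\<^sub>r\<close>, i.e. to
  \<open>r\<^sup>d\<^sup>-\<^sup>1\<close>.  Since the normalised weights \<open>w\<^sub>\<delta> / \<surd>V\<close> have square sum \<open>1\<close> and tend to \<open>0\<close>
  uniformly, the Lyapunov argument with characteristic functions applies.
\<close>

section \<open>Bounds for the shortest vector of \<open>\<delta> L\<close>, uniform in
  \<open>\<delta>\<close>\<close>

lemma abs_prod_le_norm_power:
  fixes x :: "real ^ 'n"
  shows "\<bar>\<Prod>i\<in>UNIV. x $ i\<bar> \<le> norm x ^ CARD('n)"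
proof -
  have "\<bar>\<Prod>i\<in>UNIV. x $ i\<bar> = (\<Prod>i\<in>UNIV. \<bar>x $ i\<bar>)"
    by (simp add: abs_prod)
  also have "\<dots> \<le> (\<Prod>i\<in>(UNIV :: 'n set). norm x)"
    by (intro prod_mono) (auto simp: component_le_norm_cart)
  finally show ?thesis by simp
qed

lemma diag_exp_mult_component: "(diag_exp t *v x) $ i = exp (real_of_int (t $ i)) * x $ i"
  by (simp add: diag_exp_def matrix_vector_mult_def if_distrib[of "\<lambda>a. a * _"] cong: if_cong)

lemma diag_exp_mult_eq_0_iff: "diag_exp t *v x = 0 \<longleftrightarrow> x = 0"
  by (simp add: vec_eq_iff diag_exp_mult_component)

lemma prod_exp_zero_sum:
  fixes t :: "int ^ 'n"
  assumes "(\<Sum>i\<in>UNIV. t $ i) = 0"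
  shows "(\<Prod>i\<in>UNIV. exp (real_of_int (t $ i))) = 1"
  using assms by (simp flip: exp_sum of_int_sum)

text \<open>\<open>Delta_le r\<close> is a set of matrices; injectivity allows counting it through
  exponent vectors.\<close>

lemma inj_diag_exp: "inj diag_exp"
proof (rule injI)
  fix s t :: "int ^ 'n"
  assume eq: "diag_exp s = diag_exp t"
  have "diag_exp s $ i $ i = diag_exp t $ i $ i" for i
    by (simp add: eq)
  then show "s = t"
    by (simp add: diag_exp_def vec_eq_iff)
qed

text \<open>
  Pigeonhole in place of Minkowski's theorem: for \<open>z \<in> [0, N)\<^sup>d\<close> the vectors \<open>diag_exp t *v (A *v z)\<close>
  lie in a box with sides \<open>2 K N e\<^sub>i\<close>, where \<open>e\<^sub>i = exp (t\<^sub>i)\<close> have product \<open>1\<close>.  For \<open>R = 4 K\<close> the box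
  is covered by about \<open>(N / 2)\<^sup>d\<close> cubes of side \<open>R\<close>, fewer than the \<open>N\<^sup>d\<close> points.
\<close>
lemma short_vector_diag_exp:
  fixes A :: "real ^ 'n ^ 'n"
  assumes A: "invertible A"
  obtains R where "R > 0"
    "\<And>t. (\<Sum>i\<in>UNIV. t $ i) = 0 \<Longrightarrow> \<exists>l \<in> (*v) (diag_exp t) ` lattice_of A - {0}. norm l \<le> R"
proof -
  \<comment> \<open>The double sum dominates every absolute row sum of \<open>A\<close>; the 1 makes
    \<open>K\<close> positive.\<close>
  define K where "K = 1 + (\<Sum>i\<in>UNIV. \<Sum>j\<in>UNIV. \<bar>A $ i $ j\<bar>)"
  have K: "K > 0"
    unfolding K_def by (intro add_pos_nonneg sum_nonneg) auto
  define R where "R = 4 * K"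
  have R: "R > 0" using K by (simp add: R_def)
  have short: "\<exists>l \<in> (*v) (diag_exp t) ` lattice_of A - {0}. norm l \<le> real CARD('n) * R"
    if t: "(\<Sum>i\<in>UNIV. t $ i) = 0" for t :: "int ^ 'n"
  proof -
    define e where "e i = exp (real_of_int (t $ i))" for i
    have e: "e i > 0" for i by (simp add: e_def)
    \<comment> \<open>\<open>(e i / 2 + 3 / N) * N\<close> will bound the number of cells in
      direction \<open>i\<close>. Since the \<open>e i\<close> have product 1, the product of the
      first factors tends to \<open>(1 / 2) ^ CARD('n)\<close>, so a large \<open>N\<close> leaves
      fewer cells than points.\<close>
    have "((\<lambda>N. \<Prod>i\<in>UNIV. e i / 2 + 3 / real N) \<longlonglongrightarrow> (\<Prod>i\<in>UNIV. e i / 2 + 0))"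
      by (intro tendsto_intros tendsto_divide_0[OF tendsto_const]
            filterlim_at_top_imp_at_infinity filterlim_real_sequentially)
    moreover have "(\<Prod>i\<in>UNIV. e i / 2 + 0) = (1 / 2) ^ CARD('n)"
      using prod_exp_zero_sum[OF t] by (simp add: prod_dividef e_def power_divide)
    moreover have "(1 / 2 :: real) ^ CARD('n) < 1"
      by (intro power_less_one_iff[THEN iffD2]) auto
    ultimately have "\<forall>\<^sub>F N in sequentially. (\<Prod>i\<in>UNIV. e i / 2 + 3 / real N) < 1"
      using order_tendstoD(2) by metis
    then have "\<forall>\<^sub>F N in sequentially. (\<Prod>i\<in>UNIV. e i / 2 + 3 / real N) < 1 \<and> N > 0"
      by (intro eventually_conj eventually_gt_at_top)
    then obtain N :: nat where N: "(\<Prod>i\<in>UNIV. e i / 2 + 3 / real N) < 1" "N > 0"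
      using eventually_happens trivial_limit_sequentially by blast
    define y where "y z = A *v of_int_vec (vec_lambda z)" for z
    define f where "f z = (\<lambda>i. \<lfloor>e i * y z $ i / R\<rfloor>)" for z
    define m where "m i = \<lceil>e i * N / 4\<rceil>" for i
    let ?S = "UNIV \<rightarrow>\<^sub>E {0..<int N} :: ('n \<Rightarrow> int) set"
    let ?T = "PiE UNIV (\<lambda>i. {- m i..m i})"
    have y_le: "\<bar>y z $ i\<bar> \<le> K * N" if z: "z \<in> ?S" for z i
    proof -
      have zN: "\<bar>real_of_int (z j)\<bar> \<le> N" for j
        using PiE_mem[OF z, of j] by auto
      have "\<bar>y z $ i\<bar> \<le> (\<Sum>j\<in>UNIV. \<bar>A $ i $ j * z j\<bar>)"
        by (simp add: y_def of_int_vec_def matrix_vector_mult_def)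
      also have "\<dots> \<le> (\<Sum>j\<in>UNIV. \<bar>A $ i $ j\<bar> * N)"
        by (intro sum_mono) (auto simp: abs_mult intro!: mult_left_mono zN)
      also have "\<dots> = (\<Sum>j\<in>UNIV. \<bar>A $ i $ j\<bar>) * N"
        by (simp add: sum_distrib_right)
      also have "(\<Sum>j\<in>UNIV. \<bar>A $ i $ j\<bar>) \<le> (\<Sum>i\<in>UNIV. \<Sum>j\<in>UNIV. \<bar>A $ i $ j\<bar>)"
        by (rule member_le_sum[of i UNIV "\<lambda>i. \<Sum>j\<in>UNIV. \<bar>A $ i $ j\<bar>"]) (auto intro: sum_nonneg)
      also have "\<dots> \<le> K" by (simp add: K_def)
      finally show ?thesis by (simp add: mult_right_mono)
    qed
    have f_in: "f z \<in> ?T" if z: "z \<in> ?S" for z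
    proof (rule PiE_I)
      fix i
      have "\<bar>e i * y z $ i / R\<bar> = e i * \<bar>y z $ i\<bar> / R"
        using e[of i] R by (simp add: abs_mult)
      also have "\<dots> \<le> e i * (K * N) / R"
        using e[of i] R by (intro divide_right_mono mult_left_mono y_le[OF z]) auto
      also have "\<dots> = e i * N / 4"
        using K by (simp add: R_def)
      finally have "\<bar>e i * y z $ i / R\<bar> \<le> e i * N / 4" .
      then have "- (e i * N / 4) \<le> e i * y z $ i / R" "e i * y z $ i / R \<le> e i * N / 4"
        unfolding abs_le_iff by linarith+
      then show "f z i \<in> {- m i..m i}"
        unfolding f_def m_def atLeastAtMost_iff by linarith
    qed auto
    have "card ?T < card ?S"
    proof -
      have "real (card ?T) = (\<Prod>i\<in>UNIV. real (nat (2 * m i + 1)))"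
        by (simp add: card_PiE add.commute)
      also have "\<dots> \<le> (\<Prod>i\<in>UNIV. (e i / 2 + 3 / N) * N)"
      proof (intro prod_mono conjI)
        fix i
        have "0 \<le> e i * N / 4" using e[of i] by simp
        then have "0 \<le> m i" "real_of_int (m i) \<le> e i * N / 4 + 1"
          unfolding m_def by linarith+
        \<comment> \<open>The 3 in the cell count: rounding up costs at most 1 at either end, and 0
          adds one more integer.\<close>
        then have "real (nat (2 * m i + 1)) \<le> 2 * (e i * N / 4 + 1) + 1"
          by (simp add: mult.commute)
        also have "\<dots> = (e i / 2 + 3 / N) * N"
          using N(2) by (simp add: field_simps)
        finally show "real (nat (2 * m i + 1)) \<le> (e i / 2 + 3 / N) * N" .
      qed auto
      also have "\<dots> = (\<Prod>i\<in>UNIV. e i / 2 + 3 / N) * N ^ CARD('n)"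
        by (simp add: prod.distrib)
      also have "\<dots> < 1 * real N ^ CARD('n)"
        unfolding of_nat_power using N by (intro mult_strict_right_mono) auto
      also have "\<dots> = card ?S"
        by (simp add: card_PiE)
      finally show ?thesis by simp
    qed
    then have "\<not> inj_on f ?S"
      using card_inj_on_le[of f ?S ?T] f_in by (auto simp: finite_PiE not_le image_subset_iff)
    then obtain z z' where z: "z \<in> ?S" "z' \<in> ?S" "z \<noteq> z'" "f z = f z'"
      unfolding inj_on_def by blast
    \<comment> \<open>Two points in the same cell differ by a nonzero integer vector, hence give a
      nonzero lattice point because \<open>A\<close> is injective. Its image under
      \<open>diag_exp t\<close> is at most one cell side \<open>R\<close> in each
      coordinate.\<close>
    define u where "u = (vec_lambda z - vec_lambda z' :: int ^ 'n)"
    have u: "of_int_vec u = of_int_vec (vec_lambda z) - (of_int_vec (vec_lambda z') :: real ^ 'n)"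
      by (simp add: u_def of_int_vec_def vec_eq_iff)
    have "of_int_vec u \<noteq> (0 :: real ^ 'n)"
      using z(3) by (auto simp: u_def of_int_vec_def vec_eq_iff)
    moreover obtain B where B: "B ** A = mat 1"
      using A by (auto simp: invertible_def)
    ultimately have "A *v of_int_vec u \<noteq> 0"
      by (metis matrix_vector_mul_assoc matrix_vector_mul_lid matrix_vector_mult_0_right)
    then have nz: "diag_exp t *v (A *v of_int_vec u) \<noteq> 0"
      by (simp add: diag_exp_mult_eq_0_iff)
    have comp: "\<bar>(diag_exp t *v (A *v of_int_vec u)) $ i\<bar> \<le> R" for i
    proof -
      have "f z i = f z' i" by (simp add: z(4))
      then have "\<bar>e i * y z $ i / R - e i * y z' $ i / R\<bar> \<le> 1"
        unfolding f_def by linarith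
      then have "\<bar>e i * y z $ i - e i * y z' $ i\<bar> \<le> R"
        using R by (simp add: diff_divide_distrib[symmetric])
      then show ?thesis
        by (simp add: diag_exp_mult_component u matrix_vector_mult_diff_distrib e_def y_def
            right_diff_distrib)
    qed
    have "norm (diag_exp t *v (A *v of_int_vec u)) \<le> (\<Sum>i\<in>(UNIV :: 'n set). R)"
      by (rule order_trans[OF norm_le_l1_cart]) (intro sum_mono comp)
    then have "norm (diag_exp t *v (A *v of_int_vec u)) \<le> CARD('n) * R" by simp
    moreover have "A *v of_int_vec u \<in> lattice_of A"
      by (auto simp: lattice_of_def)
    ultimately show ?thesis using nz by blast
  qed
  show thesis
    by (rule that[of "CARD('n) * R"]) (use R short in auto)
qed

text \<open>The coordinate product is invariant under \<open>\<delta>\<close>, so all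
  \<open>\<delta> L\<close> are admissible with the same constant, which keeps their nonzero points
  away from 0. The upper bound is \<open>short_vector_diag_exp\<close>.\<close>

lemma lattice_norm_diag_exp_bounds:
  fixes L :: "(real ^ 'n) set"
  assumes L: "unimodular_lattice L" "admissible L"
  obtains c C where "c > 0" "C > 0"
    "\<And>\<delta>. \<delta> \<in> Delta \<Longrightarrow> c \<le> lattice_norm ((*v) \<delta> ` L)"
    "\<And>\<delta>. \<delta> \<in> Delta \<Longrightarrow> lattice_norm ((*v) \<delta> ` L) \<le> C"
proof -
  obtain A where A: "\<bar>det A\<bar> = 1" "L = lattice_of A"
    using L(1) by (auto simp: unimodular_lattice_def)
  then have "invertible A"
    by (auto simp: invertible_det_nz)
  then obtain R where R: "R > 0"
    "\<And>t. (\<Sum>i\<in>UNIV. t $ i) = 0 \<Longrightarrow> \<exists>l \<in> (*v) (diag_exp t) ` L - {0}. norm l \<le> R"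
    using short_vector_diag_exp[of A] A(2) by metis
  obtain b where b: "b > 0" "\<And>l. l \<in> L - {0} \<Longrightarrow> b \<le> \<bar>\<Prod>i\<in>UNIV. l $ i\<bar>"
    using L(2) by (auto simp: admissible_def)
  \<comment> \<open>Chosen so that \<open>b \<le> norm l ^ CARD('n)\<close> becomes
    \<open>c \<le> norm l\<close>.\<close>
  define c where "c = root CARD('n) b"
  have c: "c > 0" using b(1) by (simp add: c_def)
  have lower: "c \<le> norm l"
    if t: "(\<Sum>i\<in>UNIV. t $ i) = 0" and l: "l \<in> (*v) (diag_exp t) ` L - {0}" for t l
  proof -
    obtain x where x: "x \<in> L" "l = diag_exp t *v x" "x \<noteq> 0"
      using l by (auto simp: diag_exp_mult_eq_0_iff)
    have "c ^ CARD('n) = b"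
      using b(1) by (simp add: c_def)
    also have "\<dots> \<le> \<bar>\<Prod>i\<in>UNIV. x $ i\<bar>"
      using b(2) x by simp
    also have "\<dots> = \<bar>\<Prod>i\<in>UNIV. l $ i\<bar>"
      using prod_exp_zero_sum[OF t] by (simp add: x(2) diag_exp_mult_component prod.distrib)
    also have "\<dots> \<le> norm l ^ CARD('n)"
      by (rule abs_prod_le_norm_power)
    finally show ?thesis
      using c by (simp add: power_mono_iff)
  qed
  show thesis
  proof (rule that[OF c R(1)])
    fix \<delta> :: "real ^ 'n ^ 'n" assume "\<delta> \<in> Delta"
    then obtain t where t: "\<delta> = diag_exp t" "(\<Sum>i\<in>UNIV. t $ i) = 0"
      by (auto simp: Delta_def)
    obtain l where l: "l \<in> (*v) \<delta> ` L - {0}" "norm l \<le> R"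
      using R(2)[OF t(2)] t(1) by blast
    show "c \<le> lattice_norm ((*v) \<delta> ` L)"
      unfolding lattice_norm_def
    proof (rule cInf_greatest)
      show "norm ` ((*v) \<delta> ` L - {0}) \<noteq> {}" using l(1) by blast
      show "c \<le> x" if "x \<in> norm ` ((*v) \<delta> ` L - {0})" for x
        using that lower[OF t(2)] t(1) by blast
    qed
    have "bdd_below (norm ` ((*v) \<delta> ` L - {0}))"
      by (rule bdd_belowI[of _ 0]) auto
    then have "lattice_norm ((*v) \<delta> ` L) \<le> norm l"
      unfolding lattice_norm_def using l(1) by (intro cInf_lower imageI)
    then show "lattice_norm ((*v) \<delta> ` L) \<le> R" using l(2) by simp
  qed
qed

section \<open>Counting the elements of \<open>Delta_le r\<close>\<close>

text \<open>A zero-sum vector is determined by its coordinates other than a fixed \<open>k\<close>,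
  and each of these takes at most \<open>2 * \<lfloor>r\<rfloor> + 1 \<le> 3 * r\<close>
  values.\<close>

lemma card_Delta_le_upper:
  assumes "r \<ge> 1"
  shows "real (card (Delta_le r :: (real ^ 'n ^ 'n) set)) \<le> (3 * r) ^ (CARD('n) - 1)"
proof -
  define T :: "(int ^ 'n) set"
    where "T = {t. (\<Sum>i\<in>UNIV. t $ i) = 0 \<and> norm (of_int_vec t) \<le> r}"
  fix k :: 'n
  define P :: "('n \<Rightarrow> int) set" where "P = PiE (UNIV - {k}) (\<lambda>_. {- \<lfloor>r\<rfloor>..\<lfloor>r\<rfloor>})"
  define f :: "int ^ 'n \<Rightarrow> 'n \<Rightarrow> int" where "f t = restrict (vec_nth t) (UNIV - {k})" for t
  have "Delta_le r = diag_exp ` T"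
    by (auto simp: Delta_le_def T_def)
  then have "card (Delta_le r :: (real ^ 'n ^ 'n) set) = card T"
    by (simp add: card_image inj_on_subset[OF inj_diag_exp])
  also have "\<dots> \<le> card P"
  proof (rule card_inj_on_le)
    show "inj_on f T"
    proof (rule inj_onI)
      fix s t assume st: "s \<in> T" "t \<in> T" "f s = f t"
      have ne: "s $ i = t $ i" if "i \<noteq> k" for i
        using fun_cong[OF st(3), of i] that by (simp add: f_def)
      have "(\<Sum>i\<in>UNIV. s $ i) = (\<Sum>i\<in>UNIV. t $ i)"
        using st by (simp add: T_def)
      moreover have "(\<Sum>i\<in>UNIV - {k}. s $ i) = (\<Sum>i\<in>UNIV - {k}. t $ i)"
        using ne by (intro sum.cong) auto
      ultimately have "s $ k = t $ k"
        by (simp add: sum.remove[of UNIV k])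
      then show "s = t"
        using ne by (metis vec_eq_iff)
    qed
    show "f ` T \<subseteq> P"
    proof (intro image_subsetI)
      fix t assume "t \<in> T"
      have "\<bar>real_of_int (t $ i)\<bar> \<le> r" for i
        using component_le_norm_cart[of "of_int_vec t" i] \<open>t \<in> T\<close>
        by (simp add: T_def of_int_vec_def)
      then have "t $ i \<in> {- \<lfloor>r\<rfloor>..\<lfloor>r\<rfloor>}" for i
        by (smt (verit) atLeastAtMost_iff le_floor_iff of_int_minus)
      then show "f t \<in> P"
        by (auto simp: f_def P_def)
    qed
    show "finite P" by (simp add: P_def finite_PiE)
  qed
  also have "card P = nat (2 * \<lfloor>r\<rfloor> + 1) ^ (CARD('n) - 1)"
    by (simp add: P_def card_PiE card_Diff_singleton add.commute)
  also have "real \<dots> \<le> (3 * r) ^ (CARD('n) - 1)"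
  proof -
    have "real (nat (2 * \<lfloor>r\<rfloor> + 1)) \<le> 3 * r"
      using assms by linarith
    then show ?thesis
      unfolding of_nat_power by (rule power_mono) simp
  qed
  finally show ?thesis by simp
qed

text \<open>Coordinates other than \<open>k\<close> are chosen freely in \<open>{- m..m}\<close>,
  and coordinate \<open>k\<close> restores the zero sum. The choice of \<open>m\<close> keeps the l1
  norm, hence the Euclidean norm, below \<open>r\<close>.\<close>

lemma card_Delta_le_lower:
  assumes "r \<ge> 0"
  shows "(r / (2 * CARD('n))) ^ (CARD('n) - 1) \<le> real (card (Delta_le r :: (real ^ 'n ^ 'n) set))"
proof -
  fix k :: 'n
  define m where "m = \<lfloor>r / (2 * CARD('n))\<rfloor>"
  define P :: "('n \<Rightarrow> int) set" where "P = PiE (UNIV - {k}) (\<lambda>_. {- m..m})"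
  define g :: "('n \<Rightarrow> int) \<Rightarrow> int ^ 'n"
    where "g s = (\<chi> i. if i = k then - (\<Sum>j\<in>UNIV - {k}. s j) else s i)" for s
  have m0: "m \<ge> 0" using assms by (simp add: m_def)
  \<comment> \<open>The loss from rounding down is absorbed by
    \<open>x \<le> 2 * \<lfloor>x\<rfloor> + 1\<close> for \<open>x \<ge> 0\<close>.\<close>
  have "r / (2 * CARD('n)) \<le> nat (2 * m + 1)"
    using m0 unfolding m_def by linarith
  then have "(r / (2 * CARD('n))) ^ (CARD('n) - 1) \<le> nat (2 * m + 1) ^ (CARD('n) - 1)"
    using assms by (simp add: power_mono)
  also have "\<dots> = card P"
    by (simp add: P_def card_PiE card_Diff_singleton add.commute)
  also have "card P \<le> card (Delta_le r :: (real ^ 'n ^ 'n) set)"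
  proof (rule card_inj_on_le)
    show "inj_on (diag_exp \<circ> g) P"
    proof (intro comp_inj_on inj_on_subset[OF inj_diag_exp] subset_UNIV inj_onI)
      fix s t assume st: "s \<in> P" "t \<in> P" "g s = g t"
      show "s = t"
      proof (rule PiE_ext[OF st(1,2)[unfolded P_def]])
        fix i assume "i \<in> UNIV - {k}"
        then show "s i = t i"
          using arg_cong[OF st(3), of "\<lambda>v. v $ i"] by (simp add: g_def)
      qed
    qed
    show "(diag_exp \<circ> g) ` P \<subseteq> Delta_le r"
    proof (intro image_subsetI)
      fix s assume s: "s \<in> P"
      have s_le: "\<bar>s i\<bar> \<le> m" if "i \<noteq> k" for i
        using PiE_mem[OF s[unfolded P_def], of i] that by auto
      have sum: "(\<Sum>i\<in>UNIV. g s $ i) = 0"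
        by (simp add: sum.remove[of UNIV k] g_def)
      have rest: "(\<Sum>i\<in>UNIV - {k}. \<bar>s i\<bar>) \<le> CARD('n) * m"
      proof -
        have "(\<Sum>i\<in>UNIV - {k}. \<bar>s i\<bar>) \<le> (\<Sum>i\<in>UNIV - {k}. m)"
          by (intro sum_mono s_le) auto
        also have "\<dots> \<le> (\<Sum>i\<in>(UNIV :: 'n set). m)"
          by (intro sum_mono2) (use m0 in auto)
        finally show ?thesis by simp
      qed
      \<comment> \<open>Coordinate \<open>k\<close> contributes at most as much as all others
        together, whence the factor 2 in \<open>m\<close>.\<close>
      have "(\<Sum>i\<in>UNIV. \<bar>g s $ i\<bar>) = \<bar>\<Sum>i\<in>UNIV - {k}. s i\<bar> + (\<Sum>i\<in>UNIV - {k}. \<bar>s i\<bar>)"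
        by (simp add: sum.remove[of UNIV k] g_def)
      also have "\<dots> \<le> 2 * (CARD('n) * m)"
        using rest sum_abs[of s "UNIV - {k}"] by linarith
      finally have "(\<Sum>i\<in>UNIV. \<bar>g s $ i\<bar>) \<le> 2 * CARD('n) * m" by simp
      then have "real_of_int (\<Sum>i\<in>UNIV. \<bar>g s $ i\<bar>) \<le> real_of_int (2 * CARD('n) * m)"
        by (rule of_int_le_iff[THEN iffD2])
      then have "norm (of_int_vec (g s)) \<le> 2 * CARD('n) * m"
        using norm_le_l1_cart[of "of_int_vec (g s)"] by (simp add: of_int_vec_def)
      also have "\<dots> = 2 * CARD('n) * real_of_int m" by simp
      also have "\<dots> \<le> 2 * CARD('n) * (r / (2 * CARD('n)))"
        unfolding m_def by (rule mult_left_mono[OF of_int_floor_le]) simp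
      also have "\<dots> = r" by simp
      finally show "(diag_exp \<circ> g) s \<in> Delta_le r"
        using sum by (auto simp: Delta_le_def)
    qed
    show "finite (Delta_le r :: (real ^ 'n ^ 'n) set)" by (rule finite_Delta_le)
  qed
  finally show ?thesis by simp
qed

section \<open>Characteristic functions of weighted sums\<close>

lemma abs_exp_minus_sub_le:
  fixes x :: real
  assumes "x \<ge> 0"
  shows "\<bar>exp (- x) - (1 - x)\<bar> \<le> x\<^sup>2"
proof -
  have "exp (- x) \<le> 1 / (1 + x)"
    using exp_ge_add_one_self[of x] assms by (simp add: exp_minus field_simps)
  \<comment> \<open>This is
    \<open>(1 + x) * (1 - x + x\<^sup>2) = 1 + x ^ 3 \<ge> 1\<close>.\<close>
  also have "\<dots> \<le> 1 - x + x\<^sup>2"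
    using assms by (simp add: field_simps power2_eq_square)
  finally show ?thesis
    using exp_ge_add_one_self[of "- x"] by simp
qed

lemma char_distr_scale:
  assumes "f \<in> borel_measurable M"
  shows "char (distr M borel (\<lambda>x. c * f x)) t = char (distr M borel f) (c * t)"
  using assms by (simp add: char_def integral_distr mult_ac)

lemma char_normal_scaled:
  "char (distr std_normal_distribution borel (\<lambda>x. \<sigma> * x)) t
    = complex_of_real (exp (- (\<sigma> * t)\<^sup>2 / 2))"
  using char_distr_scale[of "\<lambda>x. x" std_normal_distribution \<sigma> t]
  by (simp add: distr_id2 char_std_normal_distribution)

text \<open>Both functions are compared with \<open>1 - u\<^sup>2 * s / 2\<close>. The first error
  comes from \<open>char_approx3'\<close>, keeping the cubic branch of its minimum, the second from
  \<open>abs_exp_minus_sub_le\<close>.\<close>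

lemma (in prob_space) char_sub_gaussian_le:
  fixes X :: "'a \<Rightarrow> real"
  assumes X[measurable]: "random_variable borel X"
    and int: "integrable M X" "integrable M (\<lambda>\<omega>. (X \<omega>)\<^sup>2)" "integrable M (\<lambda>\<omega>. \<bar>X \<omega>\<bar> ^ 3)"
    and mean: "expectation X = 0"
    and var: "expectation (\<lambda>\<omega>. (X \<omega>)\<^sup>2) = s"
  shows "cmod (char (distr M borel X) u - complex_of_real (exp (- (u\<^sup>2 * s / 2))))
    \<le> \<bar>u\<bar> ^ 3 / 6 * expectation (\<lambda>\<omega>. \<bar>X \<omega>\<bar> ^ 3) + (u\<^sup>2 * s / 2)\<^sup>2"
proof -
  have s: "s \<ge> 0" using var by (metis integral_nonneg_AE zero_le_power2 always_eventually)
  have "cmod (char (distr M borel X) u - (1 - u\<^sup>2 * s / 2))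
      \<le> (u\<^sup>2 / 6) * expectation (\<lambda>\<omega>. min (6 * (X \<omega>)\<^sup>2) (\<bar>u\<bar> * \<bar>X \<omega>\<bar> ^ 3))"
    by (rule char_approx3'[OF X int(1,2) mean _ refl]) (simp add: mean var)
  also have "\<dots> \<le> (u\<^sup>2 / 6) * expectation (\<lambda>\<omega>. \<bar>u\<bar> * \<bar>X \<omega>\<bar> ^ 3)"
    by (intro mult_left_mono integral_mono integrable_min) (use int in auto)
  also have "\<dots> = \<bar>u\<bar> ^ 3 / 6 * expectation (\<lambda>\<omega>. \<bar>X \<omega>\<bar> ^ 3)"
    by (simp add: power3_eq_cube power2_eq_square abs_mult_self_eq mult_ac)
  finally have 1: "cmod (char (distr M borel X) u - (1 - u\<^sup>2 * s / 2))
      \<le> \<bar>u\<bar> ^ 3 / 6 * expectation (\<lambda>\<omega>. \<bar>X \<omega>\<bar> ^ 3)" .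
  have "cmod ((1 - u\<^sup>2 * s / 2) - complex_of_real (exp (- (u\<^sup>2 * s / 2))))
      = \<bar>exp (- (u\<^sup>2 * s / 2)) - (1 - u\<^sup>2 * s / 2)\<bar>"
    by (subst norm_minus_commute)
       (simp add: norm_of_real[symmetric, where 'a=complex] del: norm_of_real)
  also have "\<dots> \<le> (u\<^sup>2 * s / 2)\<^sup>2"
    by (rule abs_exp_minus_sub_le) (use s in auto)
  finally show ?thesis
    using 1 norm_triangle_ineq[of "char (distr M borel X) u - (1 - u\<^sup>2 * s / 2)"
        "(1 - u\<^sup>2 * s / 2) - complex_of_real (exp (- (u\<^sup>2 * s / 2)))"]
    by simp
qed

text \<open>Quantitative Lyapunov estimate: both sides factor over \<open>I\<close>, and each factor
  contributes an error of order \<open>(a i)\<^sup>2 * \<epsilon>\<close> for small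
  \<open>\<epsilon>\<close>. As the squares sum to 1, the total vanishes with
  \<open>\<epsilon>\<close>, however large \<open>I\<close> is.\<close>

lemma (in prob_space) char_weighted_sum_sub_gaussian_le:
  fixes X :: "'i \<Rightarrow> 'a \<Rightarrow> real"
  assumes indep: "indep_vars (\<lambda>_. borel) X I"
    and int: "\<And>i. i \<in> I \<Longrightarrow> integrable M (X i)" "\<And>i. i \<in> I \<Longrightarrow> integrable M (\<lambda>\<omega>. (X i \<omega>)\<^sup>2)"
      "\<And>i. i \<in> I \<Longrightarrow> integrable M (\<lambda>\<omega>. \<bar>X i \<omega>\<bar> ^ 3)"
    and mean: "\<And>i. i \<in> I \<Longrightarrow> expectation (X i) = 0"
    and var: "\<And>i. i \<in> I \<Longrightarrow> expectation (\<lambda>\<omega>. (X i \<omega>)\<^sup>2) = s"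
    and third: "\<And>i. i \<in> I \<Longrightarrow> expectation (\<lambda>\<omega>. \<bar>X i \<omega>\<bar> ^ 3) \<le> \<rho>"
    and a: "(\<Sum>i\<in>I. (a i)\<^sup>2) = 1" "\<And>i. i \<in> I \<Longrightarrow> \<bar>a i\<bar> \<le> \<epsilon>"
  shows "cmod (char (distr M borel (\<lambda>\<omega>. \<Sum>i\<in>I. a i * X i \<omega>)) u
      - complex_of_real (exp (- (u\<^sup>2 * s / 2)))) \<le> \<epsilon> * (\<bar>u\<bar> ^ 3 / 6 * \<rho>) + \<epsilon>\<^sup>2 * (u\<^sup>2 * s / 2)\<^sup>2"
proof -
  \<comment> \<open>A sum over an infinite or empty set is 0, not 1.\<close>
  have I: "finite I" "I \<noteq> {}"
    using a(1) by (auto intro: ccontr)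
  then obtain i0 where i0: "i0 \<in> I" by blast
  have X[measurable]: "random_variable borel (X i)" if "i \<in> I" for i
    using indep that unfolding indep_vars_def2 by simp
  have \<rho>: "\<rho> \<ge> 0"
    by (rule order_trans[OF _ third[OF i0]]) simp
  have s: "s \<ge> 0"
    using var[OF i0] by (metis integral_nonneg_AE zero_le_power2 always_eventually)
  define w where "w i = exp (- ((a i * u)\<^sup>2 * s / 2))" for i
  have "char (distr M borel (\<lambda>\<omega>. \<Sum>i\<in>I. a i * X i \<omega>)) u
      = (\<Prod>i\<in>I. char (distr M borel (\<lambda>\<omega>. a i * X i \<omega>)) u)"
    by (intro char_distr_sum indep_vars_compose2[OF indep]) auto
  also have "\<dots> = (\<Prod>i\<in>I. char (distr M borel (X i)) (a i * u))"
    by (intro prod.cong refl char_distr_scale X)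
  finally have char_eq: "char (distr M borel (\<lambda>\<omega>. \<Sum>i\<in>I. a i * X i \<omega>)) u = \<dots>" .
  have "(\<Sum>i\<in>I. - ((a i * u)\<^sup>2 * s / 2)) = - ((\<Sum>i\<in>I. (a i)\<^sup>2) * (u\<^sup>2 * s / 2))"
    unfolding sum_distrib_right sum_negf[symmetric] by (simp add: power_mult_distrib mult_ac)
  then have exp_eq: "exp (- (u\<^sup>2 * s / 2)) = (\<Prod>i\<in>I. w i)"
    using a(1) I(1) by (simp add: w_def flip: exp_sum)
  \<comment> \<open>For factors of modulus at most 1, the difference of two products is at most the
    sum of the differences of the factors.\<close>
  have "cmod ((\<Prod>i\<in>I. char (distr M borel (X i)) (a i * u)) - (\<Prod>i\<in>I. complex_of_real (w i)))
      \<le> (\<Sum>i\<in>I. cmod (char (distr M borel (X i)) (a i * u) - complex_of_real (w i)))"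
  proof (rule norm_prod_diff)
    show "cmod (char (distr M borel (X i)) (a i * u)) \<le> 1" if "i \<in> I" for i
      by (rule real_distribution.cmod_char_le_1) (use that in simp)
    show "cmod (complex_of_real (w i)) \<le> 1" if "i \<in> I" for i
      using s by (simp add: w_def)
  qed
  also have "\<dots> \<le> (\<Sum>i\<in>I. (a i)\<^sup>2 * (\<epsilon> * (\<bar>u\<bar> ^ 3 / 6 * \<rho>) + \<epsilon>\<^sup>2 * (u\<^sup>2 * s / 2)\<^sup>2))"
  proof (rule sum_mono)
    fix i assume i: "i \<in> I"
    have "cmod (char (distr M borel (X i)) (a i * u) - complex_of_real (w i))
       \<le> \<bar>a i * u\<bar> ^ 3 / 6 * expectation (\<lambda>\<omega>. \<bar>X i \<omega>\<bar> ^ 3) + ((a i * u)\<^sup>2 * s / 2)\<^sup>2"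
      unfolding w_def by (rule char_sub_gaussian_le) (use i int mean var in auto)
    also have "\<dots> \<le> \<bar>a i * u\<bar> ^ 3 / 6 * \<rho> + ((a i * u)\<^sup>2 * s / 2)\<^sup>2"
      by (intro add_right_mono mult_left_mono third i) auto
    \<comment> \<open>With \<open>(a i)\<^sup>2\<close> taken out, the cubic term keeps one
      \<open>\<bar>a i\<bar>\<close> and the quartic term one \<open>(a i)\<^sup>2\<close>, both
      controlled by \<open>\<epsilon>\<close>.\<close>
    also have "\<dots> = (a i)\<^sup>2 * (\<bar>a i\<bar> * (\<bar>u\<bar> ^ 3 / 6 * \<rho>) + (a i)\<^sup>2 * (u\<^sup>2 * s / 2)\<^sup>2)"
    proof -
      have "\<bar>a i\<bar> ^ 3 = (a i)\<^sup>2 * \<bar>a i\<bar>"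
        by (simp add: power3_eq_cube power2_eq_square)
      then show ?thesis
        by (simp add: abs_mult power_mult_distrib algebra_simps power_divide)
    qed
    also have "\<dots> \<le> (a i)\<^sup>2 * (\<epsilon> * (\<bar>u\<bar> ^ 3 / 6 * \<rho>) + \<epsilon>\<^sup>2 * (u\<^sup>2 * s / 2)\<^sup>2)"
      using a(2)[OF i] \<rho> abs_le_square_iff[of "a i" \<epsilon>]
      by (intro mult_left_mono add_mono mult_right_mono) auto
    finally show "cmod (char (distr M borel (X i)) (a i * u) - complex_of_real (w i))
      \<le> (a i)\<^sup>2 * (\<epsilon> * (\<bar>u\<bar> ^ 3 / 6 * \<rho>) + \<epsilon>\<^sup>2 * (u\<^sup>2 * s / 2)\<^sup>2)" .
  qed
  also have "\<dots> = \<epsilon> * (\<bar>u\<bar> ^ 3 / 6 * \<rho>) + \<epsilon>\<^sup>2 * (u\<^sup>2 * s / 2)\<^sup>2"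
    by (simp add: a(1) flip: sum_distrib_right)
  finally show ?thesis
    by (simp add: char_eq exp_eq)
qed

section \<open>Weak convergence along a real parameter, and moments\<close>

text \<open>A limit at infinity can be tested on sequences tending to infinity, and to these Levy's
  continuity theorem applies.\<close>

lemma weak_conv_along_at_topI:
  fixes \<mu> :: "real \<Rightarrow> real measure"
  assumes \<mu>: "\<And>r. real_distribution (\<mu> r)" and \<nu>: "real_distribution \<nu>"
    and char: "\<And>u. ((\<lambda>r. char (\<mu> r) u) \<longlongrightarrow> char \<nu> u) at_top"
  shows "weak_conv_along \<mu> \<nu> at_top"
  unfolding weak_conv_along_def
proof (intro allI impI tendsto_at_topI_sequentially)
  fix x and Y :: "nat \<Rightarrow> real"
  assume x: "isCont (cdf \<nu>) x" and Y: "filterlim Y at_top sequentially"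
  have "weak_conv_m (\<lambda>n. \<mu> (Y n)) \<nu>"
    by (rule levy_continuity[OF \<mu> \<nu>]) (rule filterlim_compose[OF char Y])
  then show "(\<lambda>n. cdf (\<mu> (Y n)) x) \<longlonglongrightarrow> cdf \<nu> x"
    using x by (simp add: weak_conv_m_def weak_conv_def)
qed

text \<open>Domination by \<open>1 + \<bar>X\<bar> ^ 3\<close>, which is integrable on a probability
  space.\<close>

lemma (in prob_space) integrable_lower_moments:
  fixes X :: "'a \<Rightarrow> real"
  assumes X[measurable]: "random_variable borel X" and int: "integrable M (\<lambda>\<omega>. \<bar>X \<omega>\<bar> ^ 3)"
  shows "integrable M X" "integrable M (\<lambda>\<omega>. (X \<omega>)\<^sup>2)"
proof -
  have dom: "integrable M (\<lambda>\<omega>. 1 + \<bar>X \<omega>\<bar> ^ 3)"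
    using int by simp
  have bound: "y ^ k \<le> 1 + y ^ 3" if "y \<ge> 0" "k \<le> 3" for y :: real and k :: nat
  proof (cases "y \<le> 1")
    case True
    then show ?thesis
      using that power_le_one[of y k] by (simp add: add_increasing2)
  next
    case False
    then have "y ^ k \<le> y ^ 3"
      using that by (intro power_increasing) auto
    then show ?thesis by simp
  qed
  show "integrable M X"
    by (rule Bochner_Integration.integrable_bound[OF dom X])
       (use bound[of "\<bar>X _\<bar>" 1] in \<open>simp add: abs_of_nonneg\<close>)
  show "integrable M (\<lambda>\<omega>. (X \<omega>)\<^sup>2)"
    by (rule Bochner_Integration.integrable_bound[OF dom])
       (use bound[of "\<bar>X _\<bar>" 2] in \<open>simp_all add: abs_of_nonneg\<close>)
qed

text \<open>Symmetry makes the integral equal to its own negative; for a non-integrable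
  \<open>X\<close> it has the default value 0.\<close>

lemma integral_eq_0_of_symmetric:
  fixes X :: "'a \<Rightarrow> real"
  assumes [measurable]: "X \<in> borel_measurable M"
    and symm: "distr M borel X = distr M borel (\<lambda>\<omega>. - X \<omega>)"
  shows "(\<integral>\<omega>. X \<omega> \<partial>M) = 0"
proof -
  have "(\<integral>\<omega>. X \<omega> \<partial>M) = (\<integral>x. x \<partial>distr M borel X)"
    by (simp add: integral_distr)
  also have "\<dots> = (\<integral>\<omega>. - X \<omega> \<partial>M)"
    by (subst symm) (simp add: integral_distr)
  finally show ?thesis by simp
qed

section \<open>Growth of \<open>V_tilde\<close> and the limit law\<close>

text \<open>Every summand lies between \<open>1 / C ^ (2 * CARD('n))\<close> and
  \<open>1 / c ^ (2 * CARD('n))\<close>, so the two bounds on the cardinality of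
  \<open>Delta_le r\<close> carry over to \<open>V_tilde L r\<close>.\<close>

lemma V_tilde_bounds:
  fixes L :: "(real ^ 'n) set"
  assumes c: "c > 0" "\<And>\<delta>. \<delta> \<in> Delta \<Longrightarrow> c \<le> lattice_norm ((*v) \<delta> ` L)"
    and C: "C > 0" "\<And>\<delta>. \<delta> \<in> Delta \<Longrightarrow> lattice_norm ((*v) \<delta> ` L) \<le> C"
  obtains K where "K > 0" "\<And>r. r \<ge> 1 \<Longrightarrow> 1 / K * r ^ (CARD('n) - 1) \<le> V_tilde L r"
    "\<And>r. r \<ge> 1 \<Longrightarrow> V_tilde L r \<le> K * r ^ (CARD('n) - 1)"
proof -
  let ?D = "\<lambda>r. Delta_le r :: (real ^ 'n ^ 'n) set"
  define D where "D = CARD('n) - 1"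
  define K1 where "K1 = C ^ (2 * CARD('n)) * (2 * CARD('n)) ^ D"
  define K2 where "K2 = 3 ^ D / c ^ (2 * CARD('n))"
  have K1: "K1 > 0" and K2: "K2 > 0"
    using c C by (simp_all add: K1_def K2_def)
  have sub: "?D r \<subseteq> Delta" for r
    by (auto simp: Delta_le_def Delta_def)
  have lower: "1 / K1 * r ^ D \<le> V_tilde L r" if r: "r \<ge> 1" for r
  proof -
    have "1 / K1 * r ^ D = (r / (2 * CARD('n))) ^ D * (1 / C ^ (2 * CARD('n)))"
      by (simp add: K1_def power_divide power_mult_distrib)
    also have "\<dots> \<le> real (card (?D r)) * (1 / C ^ (2 * CARD('n)))"
      using card_Delta_le_lower[of r, where 'n='n] r C(1)
      by (intro mult_right_mono) (auto simp: D_def)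
    also have "\<dots> = (\<Sum>\<delta>\<in>?D r. 1 / C ^ (2 * CARD('n)))"
      by simp
    also have "\<dots> \<le> V_tilde L r"
      unfolding V_tilde_def
    proof (rule sum_mono)
      fix \<delta> assume "\<delta> \<in> ?D r"
      then have "\<delta> \<in> Delta" using sub by blast
      from c(2)[OF this] C(2)[OF this] c(1)
      show "1 / C ^ (2 * CARD('n)) \<le> 1 / lattice_norm ((*v) \<delta> ` L) ^ (2 * CARD('n))"
        by (intro divide_left_mono power_mono mult_pos_pos zero_less_power) auto
    qed
    finally show ?thesis .
  qed
  have upper: "V_tilde L r \<le> K2 * r ^ D" if r: "r \<ge> 1" for r
  proof -
    have "V_tilde L r \<le> (\<Sum>\<delta>\<in>?D r. 1 / c ^ (2 * CARD('n)))"
      unfolding V_tilde_def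
    proof (rule sum_mono)
      fix \<delta> assume "\<delta> \<in> ?D r"
      then have "\<delta> \<in> Delta" using sub by blast
      from c(2)[OF this] c(1)
      show "1 / lattice_norm ((*v) \<delta> ` L) ^ (2 * CARD('n)) \<le> 1 / c ^ (2 * CARD('n))"
        by (intro divide_left_mono power_mono mult_pos_pos zero_less_power) auto
    qed
    also have "\<dots> = real (card (?D r)) * (1 / c ^ (2 * CARD('n)))"
      by simp
    also have "\<dots> \<le> (3 * r) ^ D * (1 / c ^ (2 * CARD('n)))"
      using card_Delta_le_upper[OF r, where 'n='n] c(1)
      by (intro mult_right_mono) (auto simp: D_def)
    also have "\<dots> = K2 * r ^ D"
      by (simp add: K2_def power_mult_distrib)
    finally show ?thesis .
  qed
  show thesis
  proof (rule that[of "max K1 K2"])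
    show "max K1 K2 > 0" using K1 by simp
    fix r :: real assume r: "r \<ge> 1"
    have "1 / max K1 K2 * r ^ D \<le> 1 / K1 * r ^ D"
      using K1 K2 r by (intro mult_right_mono divide_left_mono) (auto intro!: mult_pos_pos)
    then show "1 / max K1 K2 * r ^ (CARD('n) - 1) \<le> V_tilde L r"
      using lower[OF r] by (simp add: D_def)
    have "K2 * r ^ D \<le> max K1 K2 * r ^ D"
      using r by (intro mult_right_mono) auto
    then show "V_tilde L r \<le> max K1 K2 * r ^ (CARD('n) - 1)"
      using upper[OF r] by (simp add: D_def)
  qed
qed

text \<open>The sum \<open>S_tilde\<close> has variance
  \<open>\<sigma>\<^sup>2 * V_tilde L r\<close>, so the limit is the centred normal law of variance
  \<open>\<sigma>\<^sup>2\<close>: the standard one for \<open>\<sigma> = 1\<close> (see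
  \<open>distr_std_normal_scale_1\<close>). As the image of the standard law under scaling, it also
  makes sense for \<open>\<sigma> = 0\<close>, as the point mass at 0.\<close>

theorem theorem2:
  fixes L :: "(real ^ 'n) set"
    and M :: "'w measure"
    and \<theta> :: "real ^ 'n ^ 'n \<Rightarrow> 'w \<Rightarrow> real"
    and \<sigma> :: real
  assumes dim: "CARD('n) \<ge> 2"
    and L: "unimodular_lattice L" "admissible L"
    and M: "prob_space M"
    and indep: "prob_space.indep_vars M (\<lambda>_. borel) \<theta> Delta"
    and ident: "\<And>\<delta> \<delta>'. \<delta> \<in> Delta \<Longrightarrow> \<delta>' \<in> Delta \<Longrightarrow> distr M borel (\<theta> \<delta>) = distr M borel (\<theta> \<delta>')"
    and symm: "\<And>\<delta>. \<delta> \<in> Delta \<Longrightarrow> distr M borel (\<theta> \<delta>) = distr M borel (\<lambda>\<omega>. - \<theta> \<delta> \<omega>)"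
    and moment3: "\<And>\<delta>. \<delta> \<in> Delta \<Longrightarrow> integrable M (\<lambda>\<omega>. \<bar>\<theta> \<delta> \<omega>\<bar> ^ 3)"
    and \<sigma>: "\<sigma> \<ge> 0" "\<And>\<delta>. \<delta> \<in> Delta \<Longrightarrow> (\<integral>\<omega>. (\<theta> \<delta> \<omega>)\<^sup>2 \<partial>M) = \<sigma>\<^sup>2"
  shows "(\<exists>C>0. \<forall>\<^sub>F r in at_top.
            1 / C * r ^ (CARD('n) - 1) \<le> V_tilde L r \<and> V_tilde L r \<le> C * r ^ (CARD('n) - 1)) \<and>
         weak_conv_along
           (\<lambda>r. distr M borel (\<lambda>\<omega>. S_tilde \<theta> L \<omega> r / sqrt (V_tilde L r)))
           (distr std_normal_distribution borel (\<lambda>x. \<sigma> * x))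
           at_top"
proof
  interpret prob_space M by (rule M)
  let ?D = "\<lambda>r. Delta_le r :: (real ^ 'n ^ 'n) set"
  obtain c C where c: "c > 0" "\<And>\<delta>. \<delta> \<in> Delta \<Longrightarrow> c \<le> lattice_norm ((*v) \<delta> ` L)"
    and C: "C > 0" "\<And>\<delta>. \<delta> \<in> Delta \<Longrightarrow> lattice_norm ((*v) \<delta> ` L) \<le> C"
    using lattice_norm_diag_exp_bounds[OF L] by metis
  obtain K where K: "K > 0"
    "\<And>r. r \<ge> 1 \<Longrightarrow> 1 / K * r ^ (CARD('n) - 1) \<le> V_tilde L r"
    "\<And>r. r \<ge> 1 \<Longrightarrow> V_tilde L r \<le> K * r ^ (CARD('n) - 1)"
    using V_tilde_bounds[OF c C] by metis
  show "\<exists>C>0. \<forall>\<^sub>F r in at_top.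
      1 / C * r ^ (CARD('n) - 1) \<le> V_tilde L r \<and> V_tilde L r \<le> C * r ^ (CARD('n) - 1)"
    using K by (intro exI[of _ K] conjI eventually_mono[OF eventually_ge_at_top[of 1]]) auto

  have sub: "?D r \<subseteq> Delta" for r
    by (auto simp: Delta_le_def Delta_def)
  have \<theta>[measurable]: "random_variable borel (\<theta> \<delta>)" if "\<delta> \<in> Delta" for \<delta>
    using indep that unfolding indep_vars_def2 by simp
  define w where "w \<delta> = 1 / lattice_norm ((*v) \<delta> ` L) ^ CARD('n)" for \<delta> :: "real ^ 'n ^ 'n"
  define q where "q = 1 / c ^ CARD('n)"
  have w: "0 \<le> w \<delta>" "w \<delta> \<le> q" if "\<delta> \<in> Delta" for \<delta>
    using c(1) c(2)[OF that] unfolding w_def q_def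
    by (auto intro!: divide_left_mono power_mono mult_pos_pos zero_less_power)
  have V_eq: "V_tilde L r = (\<Sum>\<delta>\<in>?D r. (w \<delta>)\<^sup>2)" for r
    unfolding V_tilde_def w_def by (simp add: power_divide flip: power_mult) (simp add: mult.commute)
  have V_nonneg: "V_tilde L r \<ge> 0" for r
    by (simp add: V_eq sum_nonneg)
  have S_eq: "S_tilde \<theta> L \<omega> r / sqrt (V_tilde L r)
      = (\<Sum>\<delta>\<in>?D r. w \<delta> / sqrt (V_tilde L r) * \<theta> \<delta> \<omega>)" for r \<omega>
    by (simp add: S_tilde_def w_def sum_divide_distrib field_simps)
  have rv: "random_variable borel (\<lambda>\<omega>. S_tilde \<theta> L \<omega> r / sqrt (V_tilde L r))" for r
    unfolding S_eq using sub[of r] by (intro borel_measurable_sum borel_measurable_times) auto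

  \<comment> \<open>Here \<open>CARD('n) \<ge> 2\<close> makes the exponent of \<open>r\<close>
    positive.\<close>
  have V_at_top: "filterlim (V_tilde L) at_top at_top"
  proof (rule filterlim_at_top_mono)
    show "filterlim (\<lambda>r. 1 / K * r ^ (CARD('n) - 1)) at_top at_top"
      using K(1) dim
      by (intro filterlim_tendsto_pos_mult_at_top[OF tendsto_const] filterlim_pow_at_top filterlim_ident)
         auto
    show "\<forall>\<^sub>F r in at_top. 1 / K * r ^ (CARD('n) - 1) \<le> V_tilde L r"
      using K(2) by (rule eventually_mono[OF eventually_ge_at_top[of 1]])
  qed
  \<comment> \<open>A bound for all normalised weights at once; it tends to 0 because
    \<open>q\<close> does not depend on \<open>r\<close>.\<close>
  define \<epsilon> where "\<epsilon> r = q / sqrt (V_tilde L r)" for r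
  have \<epsilon>: "(\<epsilon> \<longlongrightarrow> 0) at_top"
    unfolding \<epsilon>_def
    by (intro tendsto_divide_0[OF tendsto_const] filterlim_at_top_imp_at_infinity
          filterlim_compose[OF sqrt_at_top V_at_top])

  \<comment> \<open>The identity matrix, with exponent vector 0, serves as reference element: all
    \<open>\<theta> \<delta>\<close> share its third absolute moment.\<close>
  define \<rho> where "\<rho> = expectation (\<lambda>\<omega>. \<bar>\<theta> (mat 1) \<omega>\<bar> ^ 3)"
  have one: "mat 1 \<in> Delta"
    unfolding Delta_def by (auto intro!: exI[of _ 0] simp: diag_exp_def mat_def vec_eq_iff)
  have third: "expectation (\<lambda>\<omega>. \<bar>\<theta> \<delta> \<omega>\<bar> ^ 3) = \<rho>" if \<delta>: "\<delta> \<in> Delta" for \<delta>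
  proof -
    have "expectation (\<lambda>\<omega>. \<bar>\<theta> \<delta> \<omega>\<bar> ^ 3) = (\<integral>x. \<bar>x\<bar> ^ 3 \<partial>distr M borel (\<theta> \<delta>))"
      using \<delta> by (simp add: integral_distr)
    also have "\<dots> = \<rho>"
      unfolding \<rho>_def ident[OF \<delta> one] by (simp add: integral_distr[OF \<theta>[OF one]])
    finally show ?thesis .
  qed

  let ?\<mu> = "\<lambda>r. distr M borel (\<lambda>\<omega>. S_tilde \<theta> L \<omega> r / sqrt (V_tilde L r))"
  let ?\<nu> = "distr std_normal_distribution borel (\<lambda>x. \<sigma> * x)"
  show "weak_conv_along ?\<mu> ?\<nu> at_top"
  proof (rule weak_conv_along_at_topI)
    show "real_distribution (?\<mu> r)" for r
      using rv by simp
    interpret N: real_distribution std_normal_distribution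
      by (rule real_dist_normal_dist)
    show "real_distribution ?\<nu>" by simp
    fix u :: real
    have \<nu>: "char ?\<nu> u = complex_of_real (exp (- (u\<^sup>2 * \<sigma>\<^sup>2 / 2)))"
      by (simp add: char_normal_scaled power_mult_distrib mult.commute[of "u\<^sup>2"])
    define E where "E r = \<epsilon> r * (\<bar>u\<bar> ^ 3 / 6 * \<rho>) + (\<epsilon> r)\<^sup>2 * (u\<^sup>2 * \<sigma>\<^sup>2 / 2)\<^sup>2" for r
    have "(E \<longlongrightarrow> 0 * (\<bar>u\<bar> ^ 3 / 6 * \<rho>) + 0\<^sup>2 * (u\<^sup>2 * \<sigma>\<^sup>2 / 2)\<^sup>2) at_top"
      unfolding E_def by (intro tendsto_intros \<epsilon>)
    then have E: "(E \<longlongrightarrow> 0) at_top" by simp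
    \<comment> \<open>For negative \<open>r\<close> the sum is empty and the quotients are 0 by
      convention; the normalised squares sum to 1 once \<open>V_tilde L r > 0\<close>.\<close>
    have "\<forall>\<^sub>F r in at_top. V_tilde L r > 0"
      using V_at_top by (simp add: filterlim_at_top_dense)
    then have "\<forall>\<^sub>F r in at_top. norm (char (?\<mu> r) u - char ?\<nu> u) \<le> E r"
    proof eventually_elim
      case (elim r)
      have "cmod (char (distr M borel (\<lambda>\<omega>. \<Sum>\<delta>\<in>?D r. w \<delta> / sqrt (V_tilde L r) * \<theta> \<delta> \<omega>)) u
          - complex_of_real (exp (- (u\<^sup>2 * \<sigma>\<^sup>2 / 2)))) \<le> E r"
        unfolding E_def
      proof (rule char_weighted_sum_sub_gaussian_le)
        show "indep_vars (\<lambda>_. borel) \<theta> (?D r)"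
          by (rule indep_vars_subset[OF indep sub])
        show "(\<Sum>\<delta>\<in>?D r. (w \<delta> / sqrt (V_tilde L r))\<^sup>2) = 1"
          using elim V_eq[of r] by (simp add: power_divide flip: sum_divide_distrib)
        fix \<delta> assume "\<delta> \<in> ?D r"
        then have \<delta>: "\<delta> \<in> Delta" using sub by blast
        show "integrable M (\<theta> \<delta>)" "integrable M (\<lambda>\<omega>. (\<theta> \<delta> \<omega>)\<^sup>2)"
          by (rule integrable_lower_moments[OF \<theta>[OF \<delta>] moment3[OF \<delta>]])+
        show "integrable M (\<lambda>\<omega>. \<bar>\<theta> \<delta> \<omega>\<bar> ^ 3)"
          by (rule moment3[OF \<delta>])
        show "expectation (\<theta> \<delta>) = 0"
          by (rule integral_eq_0_of_symmetric[OF \<theta>[OF \<delta>] symm[OF \<delta>]])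
        show "expectation (\<lambda>\<omega>. (\<theta> \<delta> \<omega>)\<^sup>2) = \<sigma>\<^sup>2"
          by (rule \<sigma>(2)[OF \<delta>])
        show "expectation (\<lambda>\<omega>. \<bar>\<theta> \<delta> \<omega>\<bar> ^ 3) \<le> \<rho>"
          by (simp add: third[OF \<delta>])
        show "\<bar>w \<delta> / sqrt (V_tilde L r)\<bar> \<le> \<epsilon> r"
          using w[OF \<delta>] V_nonneg[of r] by (simp add: \<epsilon>_def divide_right_mono)
      qed
      then show ?case
        by (simp only: S_eq \<nu>)
    qed
    then have "((\<lambda>r. char (?\<mu> r) u - char ?\<nu> u) \<longlongrightarrow> 0) at_top"
      by (rule Lim_null_comparison[OF _ E])
    then show "((\<lambda>r. char (?\<mu> r) u) \<longlongrightarrow> char ?\<nu> u) at_top"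
      by (simp add: LIM_zero_iff)
  qed
qed

end
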